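(* Let $d,\Delta,s$ be positive integers. There exist constants $\Lambda\in(0,1)$ and $c_0$, depending only on $d,\Delta,s$, such that the following holds. Let $X\subset\mathbb{R}^d$ be a finite set of $n$ points and $(X,\mathcal{R})$ a semi-algebraic set system generated by $\Gamma_{d,\Delta,s}$ with VC dimension $d_0$, such that the complement system $(X,\mathcal{R}^{(c)})$ has shallow cell complexity $\psi(\cdot,\cdot)$. Then for every $\varepsilon\in(0,1)$ there exists an $\varepsilon$-container $\mathcal{C}$ for $(X,\mathcal{R})$ with \[|\mathcal{C}|\le(c_0e)^{d_0}\left(\frac4\varepsilon\right)^{1+\frac{d_0}{\log(1-\Lambda/2)^{-1}}}\cdot\frac{24d_0}{\varepsilon^2}\,\psi\!\left(\frac{4d_0}{\varepsilon^2},\frac{15d_0}{\varepsilon}\right),\] where $e$ is the base of the natural logarithm; $\Lambda,c_0$ are independent of $d_0,\varepsilon,n$.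
   Context: $\Gamma_{d,\Delta,s}$ is the class of subsets of $\mathbb{R}^d$ definable by a Boolean formula with at most $s$ Boolean operations (union, intersection, complement) applied to sets $\{x:f(x)\ge0\}$ with $f$ a $d$-variate real polynomial of degree at most $\Delta$; $(X,\mathcal{R})$ is generated by $\Gamma_{d,\Delta,s}$ if every $R\in\mathcal{R}$ equals $S\cap X$ for some $S\in\Gamma_{d,\Delta,s}$. $\mathcal{R}^{(c)}=\{X\setminus R:R\in\mathcal{R}\}$. A set system $(X,\mathcal{F})$ has shallow cell complexity $\psi$ if for every finite $Y\subseteq X$ and $\ell\le|Y|$, the number of sets of size at most $\ell$ in $\{F\cap Y:F\in\mathcal{F}\}$ is at most $|Y|\,\psi(|Y|,\ell)$. An $\varepsilon$-container for $(X,\mathcal{R})$ is a collection $\mathcal{C}$ of subsets of $X$ such that for every $R\in\mathcal{R}$ there is $C\in\mathcal{C}$ with $R\subseteq C$ and $|C\setminus R|\le\varepsilon|X|$.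
   Formalization: The VC dimension d_0 is assumed to be at least 1, ψ is a real-argument function assumed non-decreasing in both arguments, and the shallow cell complexity bound is required only for nonempty Y; without these the claim is false or vacuous. *)

theory Defs
  imports "HOL-Analysis.Analysis" "HOL-Library.Extended_Nat"
begin

section \<open>Semi-algebraic sets of bounded description complexity\<close>

definition exponents :: "nat \<Rightarrow> ('d::finite \<Rightarrow> nat) set"
  where "exponents \<Delta> = {a. (\<Sum>i\<in>UNIV. a i) \<le> \<Delta>}"

text \<open>The sum over exponents below is a genuine finite sum.\<close>

lemma finite_exponents: "finite (exponents \<Delta> :: ('d::finite \<Rightarrow> nat) set)"
proof (rule finite_subset)
  show "(exponents \<Delta> :: ('d \<Rightarrow> nat) set) \<subseteq> Pi\<^sub>E UNIV (\<lambda>_. {..\<Delta>})"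
  proof
    fix a :: "'d \<Rightarrow> nat" assume a: "a \<in> exponents \<Delta>"
    have "a i \<le> (\<Sum>j\<in>UNIV. a j)" for i by (rule member_le_sum) auto
    with a show "a \<in> Pi\<^sub>E UNIV (\<lambda>_. {..\<Delta>})"
      unfolding exponents_def by (auto intro: order_trans)
  qed
  show "finite (Pi\<^sub>E (UNIV :: 'd set) (\<lambda>_. {..\<Delta>}))" by (rule finite_PiE) auto
qed

text \<open>The real polynomial functions on \<open>\<real>\<^sup>d\<close> of total degree at most \<open>\<Delta>\<close>, where
  \<open>d = CARD('d)\<close>.\<close>

definition polys_deg_le :: "nat \<Rightarrow> (real ^ 'd \<Rightarrow> real) set"
  where "polys_deg_le \<Delta> =
    {f. \<exists>c :: ('d \<Rightarrow> nat) \<Rightarrow> real.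
          f = (\<lambda>x. \<Sum>a\<in>exponents \<Delta>. c a * (\<Prod>i\<in>UNIV. (x $ i) ^ a i))}"

datatype (atoms: 'b) bool_formula =
    Atom 'b
  | Join "'b bool_formula" "'b bool_formula"
  | Meet "'b bool_formula" "'b bool_formula"
  | Neg "'b bool_formula"

fun num_ops :: "'b bool_formula \<Rightarrow> nat" where
  "num_ops (Atom _) = 0"
| "num_ops (Join p q) = num_ops p + num_ops q + 1"
| "num_ops (Meet p q) = num_ops p + num_ops q + 1"
| "num_ops (Neg p) = num_ops p + 1"

fun set_of_formula :: "'a set bool_formula \<Rightarrow> 'a set" where
  "set_of_formula (Atom S) = S"
| "set_of_formula (Join p q) = set_of_formula p \<union> set_of_formula q"
| "set_of_formula (Meet p q) = set_of_formula p \<inter> set_of_formula q"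
| "set_of_formula (Neg p) = - set_of_formula p"

text \<open>The class \<open>\<Gamma>\<^bsub>d,\<Delta>,s\<^esub>\<close>; the dimension \<open>d\<close> is carried by the type.\<close>

definition semialg_class :: "nat \<Rightarrow> nat \<Rightarrow> (real ^ 'd) set set"
  where "semialg_class \<Delta> s =
    {set_of_formula p | p.
       atoms p \<subseteq> {{x. f x \<ge> 0} | f. f \<in> polys_deg_le \<Delta>} \<and> num_ops p \<le> s}"

section \<open>Set systems\<close>

definition generated_by :: "'a set \<Rightarrow> 'a set set \<Rightarrow> 'a set set \<Rightarrow> bool"
  where "generated_by X \<R> \<Gamma> \<longleftrightarrow> (\<forall>R\<in>\<R>. \<exists>S\<in>\<Gamma>. R = S \<inter> X)"

definition complement_system :: "'a set \<Rightarrow> 'a set set \<Rightarrow> 'a set set"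
  where "complement_system X \<R> = {X - R | R. R \<in> \<R>}"

definition trace :: "'a set set \<Rightarrow> 'a set \<Rightarrow> 'a set set"
  where "trace \<F> Y = {F \<inter> Y | F. F \<in> \<F>}"

definition shatters :: "'a set set \<Rightarrow> 'a set \<Rightarrow> bool"
  where "shatters \<F> Y \<longleftrightarrow> trace \<F> Y = Pow Y"

text \<open>The supremum lives in \<open>enat\<close>, so the value is \<open>\<infinity>\<close> if arbitrarily large sets are
  shattered; the empty system, which shatters nothing, gets the value \<open>0\<close>.\<close>

definition vc_dim :: "'a set \<Rightarrow> 'a set set \<Rightarrow> enat"
  where "vc_dim X \<F> = (SUP Y\<in>{Y. Y \<subseteq> X \<and> finite Y \<and> shatters \<F> Y}. enat (card Y))"

text \<open>The bound is imposed for nonempty \<open>Y\<close> only: for \<open>Y = {}\<close> it would read \<open>1 \<le> 0\<close>,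
  so no nonempty set system would satisfy it. The function \<open>\<psi>\<close> takes real arguments because
  it is evaluated at non-integral points.\<close>

definition shallow_cell_complexity ::
    "'a set \<Rightarrow> 'a set set \<Rightarrow> (real \<Rightarrow> real \<Rightarrow> real) \<Rightarrow> bool"
  where "shallow_cell_complexity X \<F> \<psi> \<longleftrightarrow>
    (\<forall>Y l. Y \<subseteq> X \<and> finite Y \<and> Y \<noteq> {} \<and> l \<le> card Y \<longrightarrow>
       real (card {T \<in> trace \<F> Y. card T \<le> l})
         \<le> real (card Y) * \<psi> (real (card Y)) (real l))"

definition nondecreasing2 :: "(real \<Rightarrow> real \<Rightarrow> real) \<Rightarrow> bool"
  where "nondecreasing2 \<psi> \<longleftrightarrow>
    (\<forall>m m' l l'. 0 \<le> m \<and> m \<le> m' \<and> 0 \<le> l \<and> l \<le> l' \<longrightarrow> \<psi> m l \<le> \<psi> m' l')"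

text \<open>Intended for finite \<open>X\<close>, so that the cardinalities are meaningful.\<close>

definition is_container :: "real \<Rightarrow> 'a set \<Rightarrow> 'a set set \<Rightarrow> 'a set set \<Rightarrow> bool"
  where "is_container \<epsilon> X \<R> \<C> \<longleftrightarrow>
    \<C> \<subseteq> Pow X \<and>
    (\<forall>R\<in>\<R>. \<exists>C\<in>\<C>. R \<subseteq> C \<and> real (card (C - R)) \<le> \<epsilon> * real (card X))"

end

theory Submission
  imports Defs
begin

text \<open>
  The factor with \<open>\<psi>\<close> is at least \<open>1\<close> and the exponent of \<open>4/\<epsilon>\<close> exceeds any prescribed multiple of \<open>d\<^sub>0\<close>
  once \<open>\<Lambda>\<close> is small, so it suffices to find containers of size polynomial in \<open>1/\<epsilon>\<close>, with
  constants depending on \<open>d\<close>, \<open>\<Delta>\<close>, \<open>s\<close> only. In the monomial basis, \<open>f(x) \<ge> 0\<close> is a sign condition on a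
  linear form in the coefficients of \<open>f\<close>, one form for each point \<open>x\<close>. As in Megiddo's linear
  programming algorithm in fixed dimension, boundedly many guesses fix the signs of a constant
  fraction of any finite family of linear forms. Repeating this \<open>O(log(1/\<epsilon>))\<close> times on the
  unresolved points leaves at most \<open>\<epsilon>|X|\<close> of them, and these are put into the container.
  Boolean combinations of sets are handled by intersecting the resolved parts.
\<close>

section \<open>Predicates guessed correctly on a large part of a finite index set\<close>

text \<open>Each pair \<open>(T, A)\<close> below is a guess that, on \<open>T\<close>, the predicate \<open>P _ w\<close> is membership in \<open>A\<close>;
  for every \<open>w\<close> one of at most \<open>K\<close> guesses is right.\<close>

definition resolvable :: "real \<Rightarrow> nat \<Rightarrow> 'i set \<Rightarrow> 'w set \<Rightarrow> ('i \<Rightarrow> 'w \<Rightarrow> bool) \<Rightarrow> bool"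
  where "resolvable \<rho> K I W P \<longleftrightarrow>
    (\<exists>\<T> :: ('i set \<times> 'i set) set. finite \<T> \<and> card \<T> \<le> K \<and>
       (\<forall>(T, A)\<in>\<T>. T \<subseteq> I \<and> \<rho> * real (card I) \<le> real (card T)) \<and>
       (\<forall>w\<in>W. \<exists>(T, A)\<in>\<T>. \<forall>i\<in>T. P i w \<longleftrightarrow> i \<in> A))"

lemma resolvableI:
  assumes "finite \<T>" "card \<T> \<le> K"
    and "\<And>T A. (T, A) \<in> \<T> \<Longrightarrow> T \<subseteq> I \<and> \<rho> * real (card I) \<le> real (card T)"
    and "\<And>w. w \<in> W \<Longrightarrow> \<exists>T A. (T, A) \<in> \<T> \<and> (\<forall>i\<in>T. P i w \<longleftrightarrow> i \<in> A)"
  shows "resolvable \<rho> K I W P"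
  unfolding resolvable_def using assms by (intro exI[of _ \<T>]) fastforce

lemma resolvableE:
  assumes "resolvable \<rho> K I W P"
  obtains \<T> where "finite \<T>" "card \<T> \<le> K"
    and "\<forall>T A. (T, A) \<in> \<T> \<longrightarrow> T \<subseteq> I \<and> \<rho> * real (card I) \<le> real (card T)"
    and "\<forall>w\<in>W. \<exists>T A. (T, A) \<in> \<T> \<and> (\<forall>i\<in>T. P i w \<longleftrightarrow> i \<in> A)"
proof -
  from assms obtain \<T> where *: "finite \<T>" "card \<T> \<le> K"
    "\<forall>(T, A)\<in>\<T>. T \<subseteq> I \<and> \<rho> * real (card I) \<le> real (card T)"
    "\<forall>w\<in>W. \<exists>(T, A)\<in>\<T>. \<forall>i\<in>T. P i w \<longleftrightarrow> i \<in> A"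
    unfolding resolvable_def by blast
  show thesis by (rule that[OF *(1,2)]) (use *(3,4) in fast)+
qed

lemma resolvable_mono:
  assumes "resolvable \<rho> K I W P" "\<mu> \<le> \<rho>" "K \<le> K'"
  shows "resolvable \<mu> K' I W P"
proof -
  obtain \<T> where \<T>: "finite \<T>" "card \<T> \<le> K"
    and T: "\<forall>T A. (T, A) \<in> \<T> \<longrightarrow> T \<subseteq> I \<and> \<rho> * real (card I) \<le> real (card T)"
    and W: "\<forall>w\<in>W. \<exists>T A. (T, A) \<in> \<T> \<and> (\<forall>i\<in>T. P i w \<longleftrightarrow> i \<in> A)"
    using assms(1) by (rule resolvableE)
  show ?thesis
  proof (rule resolvableI[OF \<T>(1) _ _ W[rule_format]])
    show "card \<T> \<le> K'" using \<T>(2) assms(3) by simp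
    show "T \<subseteq> I \<and> \<mu> * real (card I) \<le> real (card T)" if "(T, A) \<in> \<T>" for T A
      using T[rule_format, OF that] mult_right_mono[OF assms(2), of "real (card I)"] by simp
  qed
qed

text \<open>Since \<open>J\<close> makes up at least a fraction \<open>\<mu>\<close> of
  \<open>I\<close>, guesses for \<open>J\<close> serve for \<open>I\<close>; a construction may thus
  discard all but a favourable subfamily.\<close>

lemma resolvable_superset:
  assumes "resolvable \<rho> K J W P" "J \<subseteq> I" "\<mu> * real (card I) \<le> real (card J)" "0 \<le> \<rho>"
  shows "resolvable (\<rho> * \<mu>) K I W P"
proof -
  obtain \<T> where \<T>: "finite \<T>" "card \<T> \<le> K"
    and T: "\<forall>T A. (T, A) \<in> \<T> \<longrightarrow> T \<subseteq> J \<and> \<rho> * real (card J) \<le> real (card T)"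
    and W: "\<forall>w\<in>W. \<exists>T A. (T, A) \<in> \<T> \<and> (\<forall>i\<in>T. P i w \<longleftrightarrow> i \<in> A)"
    using assms(1) by (rule resolvableE)
  show ?thesis
  proof (rule resolvableI[OF \<T>(1) \<T>(2) _ W[rule_format]])
    show "T \<subseteq> I \<and> \<rho> * \<mu> * real (card I) \<le> real (card T)" if "(T, A) \<in> \<T>" for T A
      using T[rule_format, OF that] assms(2) mult_left_mono[OF assms(3,4)] by (auto simp: mult.assoc)
  qed
qed

lemma resolvable_cong:
  assumes "resolvable \<rho> K I W P" "\<And>i w. i \<in> I \<Longrightarrow> w \<in> W \<Longrightarrow> P i w \<longleftrightarrow> Q i w"
  shows "resolvable \<rho> K I W Q"
proof -
  obtain \<T> where \<T>: "finite \<T>" "card \<T> \<le> K"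
    and T: "\<forall>T A. (T, A) \<in> \<T> \<longrightarrow> T \<subseteq> I \<and> \<rho> * real (card I) \<le> real (card T)"
    and W: "\<forall>w\<in>W. \<exists>T A. (T, A) \<in> \<T> \<and> (\<forall>i\<in>T. P i w \<longleftrightarrow> i \<in> A)"
    using assms(1) by (rule resolvableE)
  show ?thesis
  proof (rule resolvableI[OF \<T> T[rule_format]])
    show "\<exists>T A. (T, A) \<in> \<T> \<and> (\<forall>i\<in>T. Q i w \<longleftrightarrow> i \<in> A)" if "w \<in> W" for w
      using W[rule_format, OF that] T assms(2)[OF _ that] by (meson subsetD)
  qed
qed

lemma card_Sigma_le_mult:
  assumes "finite A" "card A \<le> m" "\<And>x. x \<in> A \<Longrightarrow> finite (B x) \<and> card (B x) \<le> n"
  shows "card (Sigma A B) \<le> m * n"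
proof -
  have "card (Sigma A B) = (\<Sum>x\<in>A. card (B x))"
    using assms by (intro card_SigmaI) auto
  also have "\<dots> \<le> card A * n"
    using assms(3) sum_bounded_above[of A "\<lambda>x. card (B x)" n] by simp
  also have "\<dots> \<le> m * n" using assms(2) by simp
  finally show ?thesis .
qed

text \<open>The second guess may depend on the first: its index set \<open>\<phi> T\<close> is
  computed from the set \<open>T\<close> that the first guess settles. The rounds of an iteration
  take \<open>I - T\<close>, which brings new indices; two predicates wanted on common indices take
  \<open>T\<close> itself.\<close>

lemma resolvable_sequence:
  assumes "resolvable \<rho> K I W P"
    and "\<And>T. T \<subseteq> I \<Longrightarrow> resolvable \<mu> L (\<phi> T) W Q"
  obtains \<T> where "finite \<T>" "card \<T> \<le> K * L"
    and "\<forall>T A S B. ((T, A), S, B) \<in> \<T> \<longrightarrow> T \<subseteq> I \<and> S \<subseteq> \<phi> T \<and>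
           \<rho> * real (card I) \<le> real (card T) \<and> \<mu> * real (card (\<phi> T)) \<le> real (card S)"
    and "\<forall>w\<in>W. \<exists>T A S B. ((T, A), S, B) \<in> \<T> \<and>
           (\<forall>i\<in>T. P i w \<longleftrightarrow> i \<in> A) \<and> (\<forall>i\<in>S. Q i w \<longleftrightarrow> i \<in> B)"
proof -
  obtain \<U> where \<U>: "finite \<U>" "card \<U> \<le> K"
    and U: "\<forall>T A. (T, A) \<in> \<U> \<longrightarrow> T \<subseteq> I \<and> \<rho> * real (card I) \<le> real (card T)"
    and U': "\<forall>w\<in>W. \<exists>T A. (T, A) \<in> \<U> \<and> (\<forall>i\<in>T. P i w \<longleftrightarrow> i \<in> A)"
    using assms(1) by (rule resolvableE)
  \<comment> \<open>The premise \<open>T \<subseteq> I\<close> stands inside the existential so that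
    one total choice function \<open>\<V>\<close> can be drawn.\<close>
  have "\<forall>T. \<exists>\<V>. T \<subseteq> I \<longrightarrow> finite \<V> \<and> card \<V> \<le> L \<and>
      (\<forall>S B. (S, B) \<in> \<V> \<longrightarrow> S \<subseteq> \<phi> T \<and> \<mu> * real (card (\<phi> T)) \<le> real (card S)) \<and>
      (\<forall>w\<in>W. \<exists>S B. (S, B) \<in> \<V> \<and> (\<forall>i\<in>S. Q i w \<longleftrightarrow> i \<in> B))" (is "\<forall>T. \<exists>\<V>. ?R T \<V>")
  proof
    fix T
    show "\<exists>\<V>. ?R T \<V>"
    proof (cases "T \<subseteq> I")
      case True
      from assms(2)[OF True] show ?thesis by (rule resolvableE) blast
    qed auto
  qed
  then obtain \<V> where \<V>: "\<And>T. ?R T (\<V> T)" by metis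
  have fin: "finite (\<V> (fst u)) \<and> card (\<V> (fst u)) \<le> L" if "u \<in> \<U>" for u
    using \<V>[of "fst u"] U[rule_format, of "fst u" "snd u"] that by simp
  show thesis
  proof (rule that[of "Sigma \<U> (\<lambda>u. \<V> (fst u))"])
    show "finite (Sigma \<U> (\<lambda>u. \<V> (fst u)))" using \<U>(1) fin by (intro finite_SigmaI) auto
    show "card (Sigma \<U> (\<lambda>u. \<V> (fst u))) \<le> K * L"
      using \<U> fin by (rule card_Sigma_le_mult)
    show "\<forall>T A S B. ((T, A), S, B) \<in> Sigma \<U> (\<lambda>u. \<V> (fst u)) \<longrightarrow>
        T \<subseteq> I \<and> S \<subseteq> \<phi> T \<and> \<rho> * real (card I) \<le> real (card T) \<and>
        \<mu> * real (card (\<phi> T)) \<le> real (card S)"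
    proof (intro allI impI)
      fix T A S B assume "((T, A), S, B) \<in> Sigma \<U> (\<lambda>u. \<V> (fst u))"
      then have "(T, A) \<in> \<U>" "(S, B) \<in> \<V> T" by auto
      then show "T \<subseteq> I \<and> S \<subseteq> \<phi> T \<and> \<rho> * real (card I) \<le> real (card T) \<and>
          \<mu> * real (card (\<phi> T)) \<le> real (card S)"
        using U[rule_format, of T A] \<V>[of T] by blast
    qed
    have "\<exists>T A S B. ((T, A), S, B) \<in> Sigma \<U> (\<lambda>u. \<V> (fst u)) \<and>
        (\<forall>i\<in>T. P i w \<longleftrightarrow> i \<in> A) \<and> (\<forall>i\<in>S. Q i w \<longleftrightarrow> i \<in> B)" if w: "w \<in> W" for w
    proof -
      obtain T A where TA: "(T, A) \<in> \<U>" "\<forall>i\<in>T. P i w \<longleftrightarrow> i \<in> A" using U' w by blast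
      moreover from TA have "T \<subseteq> I" using U by blast
      then obtain S B where "(S, B) \<in> \<V> T" "\<forall>i\<in>S. Q i w \<longleftrightarrow> i \<in> B"
        using \<V>[of T] w by blast
      ultimately show ?thesis by force
    qed
    then show "\<forall>w\<in>W. \<exists>T A S B. ((T, A), S, B) \<in> Sigma \<U> (\<lambda>u. \<V> (fst u)) \<and>
        (\<forall>i\<in>T. P i w \<longleftrightarrow> i \<in> A) \<and> (\<forall>i\<in>S. Q i w \<longleftrightarrow> i \<in> B)" by blast
  qed
qed

text \<open>Each round settles a fraction \<open>\<rho>\<close> of what is still open, whatever
  subset that is. The open fraction shrinks like \<open>(1 - \<rho>) ^ t\<close> while the numbers
  of guesses multiply.\<close>

lemma resolvable_iterate:
  assumes "finite I" "\<And>J. J \<subseteq> I \<Longrightarrow> resolvable \<rho> K J W P" "\<rho> \<le> 1"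
  shows "resolvable (1 - (1 - \<rho>) ^ t) (K ^ t) I W P"
proof (induction t)
  case 0
  show ?case by (rule resolvableI[of "{({}, {})}"]) auto
next
  case (Suc t)
  have *: "resolvable \<rho> K (I - T) W P" for T using assms(2) by simp
  obtain \<T> where fin: "finite \<T>" and c: "card \<T> \<le> K ^ t * K"
    and T: "\<forall>T A S B. ((T, A), S, B) \<in> \<T> \<longrightarrow> T \<subseteq> I \<and> S \<subseteq> I - T \<and>
           (1 - (1 - \<rho>) ^ t) * real (card I) \<le> real (card T) \<and>
           \<rho> * real (card (I - T)) \<le> real (card S)"
    and W: "\<forall>w\<in>W. \<exists>T A S B. ((T, A), S, B) \<in> \<T> \<and>
           (\<forall>i\<in>T. P i w \<longleftrightarrow> i \<in> A) \<and> (\<forall>i\<in>S. P i w \<longleftrightarrow> i \<in> B)"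
    by (rule resolvable_sequence[where \<phi> = "\<lambda>T. I - T", OF Suc *])
  \<comment> \<open>Outside \<open>T\<close> and \<open>S\<close> the sets \<open>A\<close> and
    \<open>B\<close> are arbitrary, so both are cut down before they are united; \<open>T\<close>
    and \<open>S\<close> are disjoint.\<close>
  let ?f = "\<lambda>((T, A), S, B). (T \<union> S, (A \<inter> T) \<union> (B \<inter> S))"
  show ?case
  proof (rule resolvableI[of "?f ` \<T>"])
    show "finite (?f ` \<T>)" using fin by simp
    show "card (?f ` \<T>) \<le> K ^ Suc t"
      using card_image_le[OF fin, of ?f] c by (simp add: mult.commute)
    show "U \<subseteq> I \<and> (1 - (1 - \<rho>) ^ Suc t) * real (card I) \<le> real (card U)"
      if "(U, C) \<in> ?f ` \<T>" for U C
    proof -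
      from that obtain T A S B where TS: "((T, A), S, B) \<in> \<T>" and U: "U = T \<union> S" by auto
      note t = T[rule_format, OF TS]
      have "finite T" "finite S" using t assms(1) by (auto intro: finite_subset)
      then have "card U = card T + card S" unfolding U using t by (intro card_Un_disjoint) auto
      moreover have d: "real (card (I - T)) = real (card I) - real (card T)"
        using t \<open>finite T\<close> assms(1) by (simp add: card_Diff_subset card_mono)
      moreover have "\<rho> * (real (card I) - real (card T)) \<le> real (card S)"
        using t d by simp
      ultimately have "real (card U) \<ge> \<rho> * real (card I) + (1 - \<rho>) * real (card T)"
        by (simp add: algebra_simps)
      moreover have "(1 - \<rho>) * ((1 - (1 - \<rho>) ^ t) * real (card I)) \<le> (1 - \<rho>) * real (card T)"
        using t assms(3) by (intro mult_left_mono) auto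
      ultimately show ?thesis using t U by (auto simp: algebra_simps)
    qed
    show "\<exists>U C. (U, C) \<in> ?f ` \<T> \<and> (\<forall>i\<in>U. P i w \<longleftrightarrow> i \<in> C)" if w: "w \<in> W" for w
    proof -
      obtain T A S B where TS: "((T, A), S, B) \<in> \<T>"
        and "\<forall>i\<in>T. P i w \<longleftrightarrow> i \<in> A" "\<forall>i\<in>S. P i w \<longleftrightarrow> i \<in> B" using W w by blast
      then have "\<forall>i\<in>T \<union> S. P i w \<longleftrightarrow> i \<in> (A \<inter> T) \<union> (B \<inter> S)" using T[rule_format, OF TS] by blast
      moreover have "(T \<union> S, (A \<inter> T) \<union> (B \<inter> S)) \<in> ?f ` \<T>" using TS by force
      ultimately show ?thesis by blast
    qed
  qed
qed

text \<open>The combinatorial core of Megiddo's pairing. \<open>G\<close> and \<open>H\<close>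
  together reveal \<open>F\<close> at one member of each pair \<open>i\<close>,
  \<open>\<pi> i\<close>; which member it is depends on whether they agree. \<open>H\<close> is
  guessed on indices where \<open>G\<close> is already settled, hence the factor
  \<open>\<rho> * \<rho>\<close>.\<close>

lemma resolvable_pairs:
  assumes fin: "finite J" and inj: "inj_on \<pi> J" and disj: "\<pi> ` J \<inter> J = {}"
    and G: "resolvable \<rho> K J W G" and H: "\<And>T. T \<subseteq> J \<Longrightarrow> resolvable \<rho> K T W H"
    and F: "\<And>i w. i \<in> J \<Longrightarrow> w \<in> W \<Longrightarrow> F (if G i w = H i w then i else \<pi> i) w \<longleftrightarrow> H i w"
    and I: "J \<union> \<pi> ` J \<subseteq> I" "\<mu> * real (card I) \<le> real (card J)" and "0 \<le> \<rho>"
  shows "resolvable (\<rho> * \<rho> * \<mu>) (K * K) I W F"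
proof -
  obtain \<T> where finT: "finite \<T>" and c: "card \<T> \<le> K * K"
    and T: "\<forall>T A S B. ((T, A), S, B) \<in> \<T> \<longrightarrow> T \<subseteq> J \<and> S \<subseteq> T \<and>
           \<rho> * real (card J) \<le> real (card T) \<and> \<rho> * real (card T) \<le> real (card S)"
    and W: "\<forall>w\<in>W. \<exists>T A S B. ((T, A), S, B) \<in> \<T> \<and>
           (\<forall>i\<in>T. G i w \<longleftrightarrow> i \<in> A) \<and> (\<forall>i\<in>S. H i w \<longleftrightarrow> i \<in> B)"
    by (rule resolvable_sequence[where \<phi> = "\<lambda>T. T", OF G H])
  \<comment> \<open>The member of each pair that a guess settles, as predicted by \<open>A\<close>
    and \<open>B\<close> in place of the true values. As the pairs are disjoint,
    \<open>e A B\<close> is injective on \<open>J\<close> and no index is lost.\<close>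
  define e where "e = (\<lambda>A B i. if (i \<in> A) = (i \<in> B) then i else \<pi> i)"
  have e_inj: "inj_on (e A B) J" for A B
    using inj disj unfolding e_def inj_on_def by (auto split: if_splits)
  let ?f = "\<lambda>((T, A), S, B). (e A B ` S, e A B ` (S \<inter> B))"
  show ?thesis
  proof (rule resolvableI[of "?f ` \<T>"])
    show "finite (?f ` \<T>)" using finT by simp
    show "card (?f ` \<T>) \<le> K * K"
      using card_image_le[OF finT, of ?f] c by simp
    show "U \<subseteq> I \<and> \<rho> * \<rho> * \<mu> * real (card I) \<le> real (card U)"
      if "(U, C) \<in> ?f ` \<T>" for U C
    proof -
      from that obtain T A S B where TS: "((T, A), S, B) \<in> \<T>" and U: "U = e A B ` S" by auto
      note t = T[rule_format, OF TS]
      have "S \<subseteq> J" using t by blast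
      then have "card U = card S" unfolding U using e_inj inj_on_subset card_image by blast
      have "\<rho> * \<rho> * \<mu> * real (card I) \<le> \<rho> * (\<rho> * real (card J))"
        using I(2) \<open>0 \<le> \<rho>\<close> by (simp add: mult.assoc mult_left_mono)
      also have "\<dots> \<le> \<rho> * real (card T)" using t \<open>0 \<le> \<rho>\<close> by (intro mult_left_mono) auto
      finally have "\<rho> * \<rho> * \<mu> * real (card I) \<le> real (card U)"
        using t \<open>card U = card S\<close> by simp
      moreover have "U \<subseteq> I" unfolding U e_def using \<open>S \<subseteq> J\<close> I(1) by auto
      ultimately show ?thesis by simp
    qed
    show "\<exists>U C. (U, C) \<in> ?f ` \<T> \<and> (\<forall>i\<in>U. F i w \<longleftrightarrow> i \<in> C)" if w: "w \<in> W" for w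
    proof -
      obtain T A S B where TS: "((T, A), S, B) \<in> \<T>"
        and A: "\<forall>i\<in>T. G i w \<longleftrightarrow> i \<in> A" and B: "\<forall>i\<in>S. H i w \<longleftrightarrow> i \<in> B" using W w by blast
      have "F (e A B i) w \<longleftrightarrow> e A B i \<in> e A B ` (S \<inter> B)" if "i \<in> S" for i
      proof -
        have i: "i \<in> T" "i \<in> J" "S \<subseteq> J" using T[rule_format, OF TS] that by auto
        have "e A B i \<in> e A B ` (S \<inter> B) \<longleftrightarrow> i \<in> S \<inter> B"
          using e_inj[of A B] i by (intro inj_on_image_mem_iff[of _ J]) auto
        moreover have "F (e A B i) w \<longleftrightarrow> H i w"
          using F[OF i(2) w] A B i that unfolding e_def by auto
        ultimately show ?thesis using B that by simp
      qed
      moreover have "(e A B ` S, e A B ` (S \<inter> B)) \<in> ?f ` \<T>" using TS by force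
      ultimately show ?thesis by blast
    qed
  qed
qed

section \<open>Linear forms: pruning in fixed dimension\<close>

lemma card_filter_split:
  assumes "finite I"
  shows "card {i\<in>I. P i} = card {i\<in>I. P i \<and> Q i} + card {i\<in>I. P i \<and> \<not> Q i}"
proof -
  have "{i\<in>I. P i} = {i\<in>I. P i \<and> Q i} \<union> {i\<in>I. P i \<and> \<not> Q i}" by blast
  moreover have "card \<dots> = card {i\<in>I. P i \<and> Q i} + card {i\<in>I. P i \<and> \<not> Q i}"
    using assms by (intro card_Un_disjoint) auto
  ultimately show ?thesis by simp
qed

text \<open>The median is taken as the least value of \<open>b\<close> with at least half of the
  indices at or below it.\<close>

lemma median_exists:
  fixes b :: "'i \<Rightarrow> real"
  assumes "finite I" "I \<noteq> {}"
  obtains m where "card I \<le> 2 * card {i\<in>I. b i \<le> m}" "card I \<le> 2 * card {i\<in>I. m \<le> b i}"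
proof -
  let ?S = "{x \<in> b ` I. card I \<le> 2 * card {i\<in>I. b i \<le> x}}"
  define m where "m = Min ?S"
  have "{i\<in>I. b i \<le> Max (b ` I)} = I" using assms by auto
  then have "Max (b ` I) \<in> ?S" using assms by simp
  then have "?S \<noteq> {}" by blast
  moreover have "finite ?S" using assms by simp
  ultimately have m: "m \<in> ?S" and min: "\<And>x. x \<in> ?S \<Longrightarrow> m \<le> x"
    unfolding m_def using Min_in[of ?S] Min_le[of ?S] by blast+
  have "2 * card {i\<in>I. b i < m} \<le> card I"
  proof (cases "{i\<in>I. b i < m} = {}")
    case False
    let ?x = "Max (b ` {i\<in>I. b i < m})"
    have fin: "finite (b ` {i\<in>I. b i < m})" using assms by simp
    have x: "?x \<in> b ` {i\<in>I. b i < m}" using False fin by (intro Max_in) auto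
    then have "{i\<in>I. b i \<le> ?x} = {i\<in>I. b i < m}"
      using Max_ge[OF fin] by fastforce
    \<comment> \<open>\<open>?x\<close> is the next smaller value of \<open>b\<close>, so by
      minimality of \<open>m\<close> fewer than half of the indices lie at or below it, that is,
      strictly below \<open>m\<close>.\<close>
    moreover have "?x \<notin> ?S" using min x by fastforce
    ultimately show ?thesis using x by auto
  next
    case True
    then show ?thesis by (simp only: card.empty)
  qed
  moreover have "card I = card {i\<in>I. b i < m} + card {i\<in>I. m \<le> b i}"
    using card_filter_split[OF assms(1), of "\<lambda>_. True" "\<lambda>i. b i < m"] by (simp add: not_less)
  ultimately show thesis using m by (intro that[of m]) auto
qed

text \<open>\<open>\<rho>\<close> and \<open>K\<close> are uniform in the family and in the
  functions \<open>g k\<close>. These are arbitrary, so the induction on \<open>N\<close> can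
  replace one of them by a combination of several. The \<open>itself\<close> arguments record the
  types of indices and parameters, which otherwise occur in bound variables alone.\<close>

definition linear_resolvable :: "'i itself \<Rightarrow> 'w itself \<Rightarrow> nat \<Rightarrow> real \<Rightarrow> nat \<Rightarrow> bool"
  where "linear_resolvable _ _ N \<rho> K \<longleftrightarrow>
    (\<forall>(I :: 'i set) (g :: nat \<Rightarrow> 'w \<Rightarrow> real) v. finite I \<longrightarrow>
       resolvable \<rho> K I UNIV (\<lambda>i w. 0 \<le> (\<Sum>k<N. v i k * g k w)))"

lemma linear_resolvableD:
  fixes I :: "'i set" and g :: "nat \<Rightarrow> 'w \<Rightarrow> real"
  assumes "linear_resolvable TYPE('i) TYPE('w) N \<rho> K" "finite I"
  shows "resolvable \<rho> K I UNIV (\<lambda>i w. 0 \<le> (\<Sum>k<N. v i k * g k w))"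
  using assms unfolding linear_resolvable_def by blast

text \<open>Although the form has \<open>N + 2\<close> terms (\<open>h\<close> being the last), only the resolvability of forms with
  \<open>N + 1\<close> terms is assumed: this is the step that raises the dimension.\<close>

lemma linear_resolvable_unit_last:
  fixes g :: "nat \<Rightarrow> 'w \<Rightarrow> real" and I :: "'i set"
  assumes IH: "linear_resolvable TYPE('i) TYPE('w) (Suc N) \<rho> K" and \<rho>: "0 < \<rho>" "\<rho> \<le> 1"
    and "finite I"
  shows "resolvable (\<rho> * \<rho> / 4) (K * K) I UNIV (\<lambda>i w. 0 \<le> (\<Sum>k<Suc N. v i k * g k w) + h w)"
    (is "resolvable _ _ _ _ ?F")
proof (cases "I = {}")
  case True
  have "resolvable \<rho> K I UNIV (\<lambda>i w. 0 \<le> (\<Sum>k<Suc N. v i k * g k w))"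
    by (rule linear_resolvableD[OF IH \<open>finite I\<close>])
  then have "resolvable \<rho> K I UNIV ?F"
    by (rule resolvable_cong) (simp add: True)
  moreover have "\<rho> * \<rho> / 4 \<le> \<rho>" using \<rho> mult_left_mono[of \<rho> 1 \<rho>] by simp
  ultimately show ?thesis by (rule resolvable_mono) (simp add: le_square)
next
  case False
  have IH': "resolvable \<rho> K J UNIV (\<lambda>i w. 0 \<le> (\<Sum>k<Suc N. v' i k * g' k w))"
    if "J \<subseteq> I" for J v' and g' :: "nat \<Rightarrow> 'w \<Rightarrow> real"
    by (rule linear_resolvableD[OF IH finite_subset[OF that \<open>finite I\<close>]])
  obtain m where m: "card I \<le> 2 * card {i\<in>I. v i N \<le> m}" "card I \<le> 2 * card {i\<in>I. m \<le> v i N}"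
    using median_exists[OF \<open>finite I\<close> False] .
  let ?E = "{i\<in>I. v i N = m}" and ?L = "{i\<in>I. v i N < m}" and ?U = "{i\<in>I. m < v i N}"
  have cards: "card {i\<in>I. v i N \<le> m} = card ?L + card ?E"
      "card {i\<in>I. m \<le> v i N} = card ?U + card ?E"
  proof -
    have "(x \<le> m \<and> x < m) = (x < m)" "(x \<le> m \<and> \<not> x < m) = (x = m)"
      "(m \<le> x \<and> m < x) = (m < x)" "(m \<le> x \<and> \<not> m < x) = (x = m)" for x by auto
    then show "card {i\<in>I. v i N \<le> m} = card ?L + card ?E"
      "card {i\<in>I. m \<le> v i N} = card ?U + card ?E"
      using card_filter_split[OF \<open>finite I\<close>, of "\<lambda>i. v i N \<le> m" "\<lambda>i. v i N < m"]
        card_filter_split[OF \<open>finite I\<close>, of "\<lambda>i. m \<le> v i N" "\<lambda>i. m < v i N"]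
      by (simp_all only:)
  qed
  \<comment> \<open>Shift of the slopes by the median:
    \<open>v i N * g N w + h w = (v i N - m) * g N w + g' N w\<close>. A form of slope exactly
    \<open>m\<close> thus loses a term, since \<open>g' N\<close> replaces both \<open>g N\<close>
    and \<open>h\<close>.\<close>
  define g' where "g' = g(N := (\<lambda>w. m * g N w + h w))"
  have g'_sum: "(\<Sum>k<N. c k * g' k w) = (\<Sum>k<N. c k * g k w)" for c w
    unfolding g'_def by (intro sum.cong) auto
  have g'_N: "g' N w = m * g N w + h w" for w unfolding g'_def by simp
  show ?thesis
  proof (cases "card I \<le> 4 * card ?E")
    case True
    let ?v = "\<lambda>i. (v i)(N := 1)"
    have "resolvable \<rho> K ?E UNIV (\<lambda>i w. 0 \<le> (\<Sum>k<Suc N. ?v i k * g' k w))"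
      by (rule IH') auto
    then have "resolvable \<rho> K ?E UNIV ?F"
    proof (rule resolvable_cong)
      fix i w assume "i \<in> ?E"
      have "(\<Sum>k<N. ?v i k * g' k w) = (\<Sum>k<N. v i k * g k w)"
        unfolding g'_sum by (intro sum.cong) auto
      then show "(0 \<le> (\<Sum>k<Suc N. ?v i k * g' k w)) = ?F i w"
        using \<open>i \<in> ?E\<close> by (simp add: g'_N add.assoc)
    qed
    then have "resolvable (\<rho> * (1/4)) K I UNIV ?F"
      by (rule resolvable_superset) (use True \<rho> in auto)
    moreover have "\<rho> * \<rho> / 4 \<le> \<rho> * (1/4)" using \<rho> mult_left_mono[of \<rho> 1 \<rho>] by simp
    ultimately show ?thesis by (rule resolvable_mono) (simp add: le_square)
  next
    case False
    define n where "n = min (card ?L) (card ?U)"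
    \<comment> \<open>Fewer than a quarter of the forms have slope \<open>m\<close>, while at least
      half lie on each closed side of it, so more than a quarter lie strictly on each side.\<close>
    have n: "card I \<le> 4 * n" unfolding n_def using False m cards by linarith
    obtain J where J: "J \<subseteq> ?U" "card J = n" "finite J"
      using obtain_subset_with_card_n[of n ?U] unfolding n_def by auto
    obtain J' where J': "J' \<subseteq> ?L" "card J' = n" "finite J'"
      using obtain_subset_with_card_n[of n ?L] unfolding n_def by auto
    obtain \<pi> where \<pi>: "bij_betw \<pi> J J'"
      using finite_same_card_bij[OF J(3) J'(3)] J(2) J'(2) by auto
    have \<pi>J: "\<pi> i \<in> ?L" if "i \<in> J" for i using \<pi> J' that bij_betwE by blast
    \<comment> \<open>The forms \<open>i\<close> and \<open>\<pi> i\<close> have opposite slopes against \<open>g N\<close> (after the shift by the median).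
      Their difference eliminates \<open>h\<close> and a positive combination eliminates \<open>g N\<close>, so both have one
      variable less; the signs of these two determine the sign of \<open>i\<close> or of \<open>\<pi> i\<close>.\<close>
    define f where "f = (\<lambda>i w. (\<Sum>k<Suc N. v i k * g k w) + h w)"
    define p q where "p = (\<lambda>i. v i N - m)" and "q = (\<lambda>i. m - v (\<pi> i) N)"
    let ?G = "\<lambda>i w. 0 \<le> f i w - f (\<pi> i) w"
    let ?H = "\<lambda>i w. 0 \<le> q i * f i w + p i * f (\<pi> i) w"
    have pq: "0 < p i" "0 < q i" if "i \<in> J" for i
      using that J(1) \<pi>J[OF that] unfolding p_def q_def by auto
    have G: "resolvable \<rho> K J UNIV ?G"
    proof (rule resolvable_cong)
      show "resolvable \<rho> K J UNIV (\<lambda>i w. 0 \<le> (\<Sum>k<Suc N. (v i k - v (\<pi> i) k) * g k w))"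
        using J(1) by (intro IH') auto
      show "(0 \<le> (\<Sum>k<Suc N. (v i k - v (\<pi> i) k) * g k w)) = ?G i w" for i w
        unfolding f_def by (simp add: left_diff_distrib sum_subtractf del: sum.lessThan_Suc)
    qed
    have H: "resolvable \<rho> K T UNIV ?H" if "T \<subseteq> J" for T
    proof (rule resolvable_cong)
      \<comment> \<open>After the shift the slopes of \<open>f i\<close> and
        \<open>f (\<pi> i)\<close> are \<open>p i\<close> and \<open>- q i\<close>; the weights
        \<open>q i\<close> and \<open>p i\<close> cancel them and leave \<open>p i + q i\<close> as
        the coefficient of \<open>g' N\<close>.\<close>
      let ?v = "\<lambda>i k. if k = N then p i + q i else q i * v i k + p i * v (\<pi> i) k"
      show "resolvable \<rho> K T UNIV (\<lambda>i w. 0 \<le> (\<Sum>k<Suc N. ?v i k * g' k w))"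
        using J(1) that by (intro IH') auto
      fix i w
      have "(\<Sum>k<N. ?v i k * g' k w) = (\<Sum>k<N. (q i * v i k + p i * v (\<pi> i) k) * g k w)"
        unfolding g'_sum by (intro sum.cong) auto
      also have "\<dots> = q i * (\<Sum>k<N. v i k * g k w) + p i * (\<Sum>k<N. v (\<pi> i) k * g k w)"
        by (simp add: sum_distrib_left distrib_right sum.distrib mult.assoc)
      finally have "(\<Sum>k<Suc N. ?v i k * g' k w) = q i * f i w + p i * f (\<pi> i) w"
        unfolding f_def p_def q_def by (simp add: g'_N algebra_simps)
      then show "(0 \<le> (\<Sum>k<Suc N. ?v i k * g' k w)) = ?H i w" by simp
    qed
    \<comment> \<open>\<open>?G\<close> tells which of the two values is the larger. A nonnegative
      combination forces the larger one to be nonnegative, a negative combination forces the smaller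
      one to be negative; agreement of \<open>?G\<close> and \<open>?H\<close> means that the forced
      one is \<open>f i\<close>.\<close>
    have F: "0 \<le> f (if ?G i w = ?H i w then i else \<pi> i) w \<longleftrightarrow> ?H i w" if "i \<in> J" for i w
    proof -
      note pq = pq[OF that]
      have nn: "0 \<le> q i * x + p i * y" if "0 \<le> x" "0 \<le> y" for x y using pq that by simp
      have neg: "q i * x + p i * y < 0" if "x < 0" "y < 0" for x y
        using pq that by (simp add: add_neg_neg mult_pos_neg)
      show ?thesis
        using nn[of "f i w" "f (\<pi> i) w"] neg[of "f i w" "f (\<pi> i) w"] by (smt (verit))
    qed
    have "resolvable (\<rho> * \<rho> * (1/4)) (K * K) I UNIV (\<lambda>i w. 0 \<le> f i w)"
    proof (rule resolvable_pairs[OF J(3) _ _ G H F])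
      show "inj_on \<pi> J" using \<pi> bij_betw_def by blast
      show "\<pi> ` J \<inter> J = {}" using \<pi>J J(1) by fastforce
      show "J \<union> \<pi> ` J \<subseteq> I" using \<pi>J J(1) by fastforce
      show "1 / 4 * real (card I) \<le> real (card J)" using n J(2) by simp
    qed (use \<rho> in auto)
    then show ?thesis unfolding f_def by simp
  qed
qed

text \<open>Dividing by \<open>v i N > 0\<close> keeps the signs and makes the last coefficient
  \<open>1\<close>. For \<open>N = 0\<close> nothing is left to eliminate: all forms are nonnegative
  exactly when \<open>g 0 w\<close> is, and the guesses "all" and "none" account for the summand
  \<open>2\<close>.\<close>

lemma linear_resolvable_pos_last:
  fixes g :: "nat \<Rightarrow> 'w \<Rightarrow> real" and I :: "'i set"
  assumes IH: "linear_resolvable TYPE('i) TYPE('w) N \<rho> K" and \<rho>: "0 < \<rho>" "\<rho> \<le> 1"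
    and "finite I" and pos: "\<And>i. i \<in> I \<Longrightarrow> 0 < v i N"
  shows "resolvable (\<rho> * \<rho> / 4) (K * K + 2) I UNIV (\<lambda>i w. 0 \<le> (\<Sum>k<Suc N. v i k * g k w))"
proof (cases N)
  case 0
  have l: "\<rho> * \<rho> / 4 \<le> 1" using mult_mono[of \<rho> 1 \<rho> 1] \<rho> by simp
  show ?thesis
  proof (rule resolvableI[of "{(I, I), (I, {})}"])
    show "card {(I, I), (I, {})} \<le> K * K + 2" by (rule order_trans[OF card_insert_le_m1]) auto
    show "T \<subseteq> I \<and> \<rho> * \<rho> / 4 * real (card I) \<le> real (card T)"
      if "(T, A) \<in> {(I, I), (I, {})}" for T A
      using that mult_right_mono[OF l, of "real (card I)"] by auto
    have sgn: "0 \<le> (\<Sum>k<Suc N. v i k * g k w) \<longleftrightarrow> 0 \<le> g 0 w" if "i \<in> I" for i w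
      using pos[OF that] 0 by (simp add: zero_le_mult_iff)
    show "\<exists>T A. (T, A) \<in> {(I, I), (I, {})} \<and>
        (\<forall>i\<in>T. 0 \<le> (\<Sum>k<Suc N. v i k * g k w) \<longleftrightarrow> i \<in> A)" for w
      by (rule exI[of _ I], rule exI[of _ "if 0 \<le> g 0 w then I else {}"]) (use sgn in auto)
  qed simp
next
  case (Suc M)
  have "resolvable (\<rho> * \<rho> / 4) (K * K) I UNIV
      (\<lambda>i w. 0 \<le> (\<Sum>k<Suc M. v i k / v i N * g k w) + g N w)"
    using IH \<rho> \<open>finite I\<close> unfolding Suc by (rule linear_resolvable_unit_last)
  then have "resolvable (\<rho> * \<rho> / 4) (K * K) I UNIV (\<lambda>i w. 0 \<le> (\<Sum>k<Suc N. v i k * g k w))"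
  proof (rule resolvable_cong)
    fix i w assume "i \<in> I"
    then have p: "0 < v i N" by (rule pos)
    then have "(\<Sum>k<Suc N. v i k * g k w) = v i N * ((\<Sum>k<Suc M. v i k / v i N * g k w) + g N w)"
      unfolding Suc by (simp add: distrib_left sum_distrib_left)
    then show "(0 \<le> (\<Sum>k<Suc M. v i k / v i N * g k w) + g N w) = (0 \<le> (\<Sum>k<Suc N. v i k * g k w))"
      using p by (simp add: zero_le_mult_iff)
  qed
  then show ?thesis by (rule resolvable_mono) auto
qed

text \<open>Induction on the number of terms. The forms are split by the sign of the last
  coefficient, and the largest of the three classes holds at least a third of them, whence the
  factor \<open>1/3\<close>.\<close>

lemma linear_resolvable_exists:
  "\<exists>\<rho> K. 0 < \<rho> \<and> \<rho> \<le> 1 \<and> linear_resolvable TYPE('i) TYPE('w) N \<rho> K"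
proof (induction N)
  case 0
  \<comment> \<open>The empty sum is nonnegative, so a single guess is right everywhere.\<close>
  have "linear_resolvable TYPE('i) TYPE('w) 0 1 1"
    unfolding linear_resolvable_def
  proof (intro allI impI)
    fix I :: "'i set" and g :: "nat \<Rightarrow> 'w \<Rightarrow> real" and v :: "'i \<Rightarrow> nat \<Rightarrow> real"
    show "resolvable 1 1 I UNIV (\<lambda>i w. 0 \<le> (\<Sum>k<0. v i k * g k w))"
      by (rule resolvableI[of "{(I, I)}"]) auto
  qed
  then show ?case by (intro exI[of _ 1]) auto
next
  case (Suc N)
  then obtain \<rho> K where \<rho>: "0 < \<rho>" "\<rho> \<le> 1" and IH: "linear_resolvable TYPE('i) TYPE('w) N \<rho> K"
    by blast
  have l: "\<rho> * \<rho> / 4 * (1/3) \<le> \<rho> * (1/3)" "\<rho> * \<rho> / 4 * (1/3) \<le> 1"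
    using mult_left_mono[of \<rho> 1 \<rho>] \<rho> by (simp_all, linarith)
  have "linear_resolvable TYPE('i) TYPE('w) (Suc N) (\<rho> * \<rho> / 4 * (1/3)) (K * K + 2)"
    unfolding linear_resolvable_def
  proof (intro allI impI)
    fix I :: "'i set" and g :: "nat \<Rightarrow> 'w \<Rightarrow> real" and v :: "'i \<Rightarrow> nat \<Rightarrow> real"
    assume fin: "finite I"
    let ?F = "\<lambda>i w. 0 \<le> (\<Sum>k<Suc N. v i k * g k w)"
    let ?Z = "{i\<in>I. v i N = 0}" and ?P = "{i\<in>I. 0 < v i N}" and ?N = "{i\<in>I. v i N < 0}"
    have "I = ?Z \<union> ?P \<union> ?N" by auto
    then have "card I \<le> card ?Z + card ?P + card ?N"
      by (metis (no_types, lifting) card_Un_le add_right_mono order_trans)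
    then consider "card I \<le> 3 * card ?Z" | "card I \<le> 3 * card ?P" | "card I \<le> 3 * card ?N"
      by linarith
    then show "resolvable (\<rho> * \<rho> / 4 * (1/3)) (K * K + 2) I UNIV ?F"
    proof cases
      case 1
      have "resolvable \<rho> K ?Z UNIV (\<lambda>i w. 0 \<le> (\<Sum>k<N. v i k * g k w))"
        using fin by (intro linear_resolvableD[OF IH]) simp
      then have "resolvable \<rho> K ?Z UNIV ?F"
        by (rule resolvable_cong) simp
      then have "resolvable (\<rho> * (1/3)) K I UNIV ?F"
        by (rule resolvable_superset) (use 1 \<rho> in auto)
      then show ?thesis using l(1) by (rule resolvable_mono) (meson le_square trans_le_add1)
    next
      case 2
      have "resolvable (\<rho> * \<rho> / 4) (K * K + 2) ?P UNIV ?F"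
        using fin by (intro linear_resolvable_pos_last[OF IH \<rho>]) auto
      then show ?thesis by (rule resolvable_superset) (use 2 in auto)
    next
      case 3
      \<comment> \<open>Negating both the last coefficient and the last function keeps every sum and
        makes that coefficient positive.\<close>
      let ?v = "\<lambda>i. (v i)(N := - v i N)" and ?g = "g(N := (\<lambda>w. - g N w))"
      have "resolvable (\<rho> * \<rho> / 4) (K * K + 2) ?N UNIV (\<lambda>i w. 0 \<le> (\<Sum>k<Suc N. ?v i k * ?g k w))"
        using fin by (intro linear_resolvable_pos_last[OF IH \<rho>]) auto
      moreover have "(\<Sum>k<Suc N. ?v i k * ?g k w) = (\<Sum>k<Suc N. v i k * g k w)" for i w
        by (rule sum.cong) auto
      ultimately have "resolvable (\<rho> * \<rho> / 4) (K * K + 2) ?N UNIV ?F" by simp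
      then show ?thesis by (rule resolvable_superset) (use 3 in auto)
    qed
  qed
  moreover have "0 < \<rho> * \<rho> / 4 * (1/3)" using \<rho> by simp
  ultimately show ?case using l(2) by blast
qed

section \<open>From linear forms to semi-algebraic sets\<close>

text \<open>A parameter matters through its behaviour on \<open>I\<close> alone, so guesses for
  \<open>V\<close> serve \<open>W\<close> if every behaviour from \<open>W\<close> occurs in
  \<open>V\<close>. This lets coefficient vectors stand in for sets.\<close>

lemma resolvable_reparam:
  assumes "resolvable \<rho> K I V P" "\<And>w. w \<in> W \<Longrightarrow> \<exists>v\<in>V. \<forall>i\<in>I. Q i w \<longleftrightarrow> P i v"
  shows "resolvable \<rho> K I W Q"
proof -
  obtain \<T> where \<T>: "finite \<T>" "card \<T> \<le> K"
    and T: "\<forall>T A. (T, A) \<in> \<T> \<longrightarrow> T \<subseteq> I \<and> \<rho> * real (card I) \<le> real (card T)"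
    and V: "\<forall>w\<in>V. \<exists>T A. (T, A) \<in> \<T> \<and> (\<forall>i\<in>T. P i w \<longleftrightarrow> i \<in> A)"
    using assms(1) by (rule resolvableE)
  show ?thesis
  proof (rule resolvableI[OF \<T> T[rule_format]])
    show "\<exists>T A. (T, A) \<in> \<T> \<and> (\<forall>i\<in>T. Q i w \<longleftrightarrow> i \<in> A)" if w: "w \<in> W" for w
    proof -
      obtain v where v: "v \<in> V" "\<forall>i\<in>I. Q i w \<longleftrightarrow> P i v" using assms(2)[OF w] by blast
      then obtain T A where TA: "(T, A) \<in> \<T>" "\<forall>i\<in>T. P i v \<longleftrightarrow> i \<in> A" using V by blast
      then have "T \<subseteq> I" using T by blast
      then have "\<forall>i\<in>T. Q i w \<longleftrightarrow> i \<in> A" using v(2) TA(2) by blast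
      then show ?thesis using TA(1) by blast
    qed
  qed
qed

lemma semialg_class_0:
  assumes "S \<in> semialg_class \<Delta> 0"
  shows "\<exists>f\<in>polys_deg_le \<Delta>. S = {x. 0 \<le> f x}"
proof -
  obtain p where p: "S = set_of_formula p" "num_ops p \<le> 0"
      "atoms p \<subseteq> {{x. f x \<ge> 0} | f. f \<in> polys_deg_le \<Delta>}"
    using assms unfolding semialg_class_def by blast
  then show ?thesis by (cases p) auto
qed

text \<open>Linearisation by monomials (the Veronese embedding) with exchanged roles: points are the
  indices and coefficient vectors the parameters. The number of terms is the number of monomials, so
  the constants are fixed before \<open>X\<close>.\<close>

lemma semialg_class_0_resolvable:
  "\<exists>\<rho> K. 0 < \<rho> \<and> \<rho> \<le> 1 \<and> (\<forall>X :: (real ^ 'd) set. finite X \<longrightarrow>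
     resolvable \<rho> K X (semialg_class \<Delta> 0) (\<lambda>x S. x \<in> S))"
proof -
  let ?E = "exponents \<Delta> :: ('d \<Rightarrow> nat) set"
  let ?N = "card ?E"
  obtain a where a: "bij_betw a {..<?N} ?E"
    using ex_bij_betw_nat_finite[OF finite_exponents] unfolding atLeast0LessThan by blast
  obtain \<rho> K where \<rho>: "0 < \<rho>" "\<rho> \<le> 1"
    and R: "linear_resolvable TYPE(real ^ 'd) TYPE(('d \<Rightarrow> nat) \<Rightarrow> real) ?N \<rho> K"
    using linear_resolvable_exists by blast
  have "resolvable \<rho> K X (semialg_class \<Delta> 0) (\<lambda>x S. x \<in> S)"
    if "finite X" for X :: "(real ^ 'd) set"
  proof (rule resolvable_reparam)
    let ?v = "\<lambda>(x :: real ^ 'd) k. \<Prod>i\<in>UNIV. (x $ i) ^ a k i"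
    show "resolvable \<rho> K X UNIV (\<lambda>x c. 0 \<le> (\<Sum>k<?N. ?v x k * c (a k)))"
      using R \<open>finite X\<close> by (rule linear_resolvableD)
    fix S :: "(real ^ 'd) set" assume "S \<in> semialg_class \<Delta> 0"
    then obtain f where f: "f \<in> polys_deg_le \<Delta>" "S = {x. 0 \<le> f x}"
      using semialg_class_0 by blast
    then obtain c where c: "f = (\<lambda>x. \<Sum>a\<in>?E. c a * (\<Prod>i\<in>UNIV. (x $ i) ^ a i))"
      unfolding polys_deg_le_def by blast
    have "f x = (\<Sum>k<?N. ?v x k * c (a k))" for x
      unfolding c by (subst sum.reindex_bij_betw[OF a, symmetric]) (simp add: mult.commute)
    then have "\<forall>x\<in>X. (x \<in> S) = (0 \<le> (\<Sum>k<?N. ?v x k * c (a k)))" using f(2) by simp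
    then show "\<exists>c\<in>UNIV. \<forall>x\<in>X. (x \<in> S) = (0 \<le> (\<Sum>k<?N. ?v x k * c (a k)))" by blast
  qed
  with \<rho> show ?thesis by blast
qed

lemma semialg_class_Suc:
  assumes "S \<in> semialg_class \<Delta> (Suc s)"
  shows "\<exists>S\<^sub>1\<in>semialg_class \<Delta> s. \<exists>S\<^sub>2\<in>semialg_class \<Delta> s.
    S = S\<^sub>1 \<union> S\<^sub>2 \<or> S = S\<^sub>1 \<inter> S\<^sub>2 \<or> S = - S\<^sub>1"
proof -
  obtain p where p: "S = set_of_formula p" "num_ops p \<le> Suc s"
      "atoms p \<subseteq> {{x. f x \<ge> 0} | f. f \<in> polys_deg_le \<Delta>}"
    using assms unfolding semialg_class_def by blast
  have sub: "set_of_formula q \<in> semialg_class \<Delta> s" if "num_ops q \<le> s" "atoms q \<subseteq> atoms p" for q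
    using that p(3) unfolding semialg_class_def by blast
  show ?thesis
  proof (cases p)
    \<comment> \<open>An atom uses no operation, so it lies in the smaller class already and counts
      as \<open>S \<union> S\<close>.\<close>
    case (Atom T)
    then have "S \<in> semialg_class \<Delta> s" using sub[of p] p(1) by simp
    then show ?thesis by blast
  next
    case (Join q r)
    then have "set_of_formula q \<in> semialg_class \<Delta> s" "set_of_formula r \<in> semialg_class \<Delta> s"
      using p(2) by (auto intro!: sub)
    then show ?thesis using p(1) Join by auto
  next
    case (Meet q r)
    then have "set_of_formula q \<in> semialg_class \<Delta> s" "set_of_formula r \<in> semialg_class \<Delta> s"
      using p(2) by (auto intro!: sub)
    then show ?thesis using p(1) Meet by auto
  next
    case (Neg q)
    then have "set_of_formula q \<in> semialg_class \<Delta> s"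
      using p(2) by (auto intro!: sub)
    then show ?thesis using p(1) Neg by auto
  qed
qed

text \<open>One family of guesses serves both operands. A pair of right guesses is right on the
  intersection of their parts, so the exceptional fractions \<open>\<delta>\<close> add up. The
  operation is guessed too, which gives the factor \<open>3\<close>.\<close>

lemma resolvable_boolean_step:
  fixes X :: "'a set"
  assumes "finite X" and R: "resolvable (1 - \<delta>) K X W (\<lambda>x S. x \<in> S)"
    and W': "\<And>S. S \<in> W' \<Longrightarrow> \<exists>S\<^sub>1\<in>W. \<exists>S\<^sub>2\<in>W. S = S\<^sub>1 \<union> S\<^sub>2 \<or> S = S\<^sub>1 \<inter> S\<^sub>2 \<or> S = - S\<^sub>1"
  shows "resolvable (1 - 2 * \<delta>) (3 * (K * K)) X W' (\<lambda>x S. x \<in> S)"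
proof -
  obtain \<T> where \<T>: "finite \<T>" "card \<T> \<le> K"
    and T: "\<forall>T A. (T, A) \<in> \<T> \<longrightarrow> T \<subseteq> X \<and> (1 - \<delta>) * real (card X) \<le> real (card T)"
    and W: "\<forall>S\<in>W. \<exists>T A. (T, A) \<in> \<T> \<and> (\<forall>x\<in>T. x \<in> S \<longleftrightarrow> x \<in> A)"
    using R by (rule resolvableE)
  let ?ops = "{(\<union>), (\<inter>), (\<lambda>A B. - A)} :: ('a set \<Rightarrow> 'a set \<Rightarrow> 'a set) set"
  let ?f = "\<lambda>(h, (T, A), (T', B)). (T \<inter> T', h A B)"
  let ?D = "?ops \<times> (\<T> \<times> \<T>)"
  have fin: "finite ?D" using \<T>(1) by simp
  show ?thesis
  proof (rule resolvableI[of "?f ` ?D"])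
    show "finite (?f ` ?D)" using fin by simp
    have "card ?D = card ?ops * (card \<T> * card \<T>)" by (simp only: card_cartesian_product)
    also have "\<dots> \<le> 3 * (K * K)"
    proof (rule mult_le_mono)
      show "card ?ops \<le> 3" by (simp add: card_insert_if)
      show "card \<T> * card \<T> \<le> K * K" using \<T>(2) by (intro mult_le_mono)
    qed
    finally show "card (?f ` ?D) \<le> 3 * (K * K)" using card_image_le[OF fin, of ?f] by linarith
    show "U \<subseteq> X \<and> (1 - 2 * \<delta>) * real (card X) \<le> real (card U)" if "(U, C) \<in> ?f ` ?D" for U C
    proof -
      from that obtain T A T' B where TA: "(T, A) \<in> \<T>" "(T', B) \<in> \<T>" and U: "U = T \<inter> T'"
        by auto
      note t = T[rule_format, OF TA(1)] T[rule_format, OF TA(2)]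
      have "finite T" "finite T'" using t assms(1) by (auto intro: finite_subset)
      then have "card T + card T' = card (T \<union> T') + card U" unfolding U by (rule card_Un_Int)
      moreover have "card (T \<union> T') \<le> card X" using t assms(1) by (intro card_mono) auto
      ultimately have "real (card T) + real (card T') \<le> real (card X) + real (card U)" by linarith
      then show ?thesis using t U by (auto simp: algebra_simps)
    qed
    show "\<exists>U C. (U, C) \<in> ?f ` ?D \<and> (\<forall>x\<in>U. x \<in> S \<longleftrightarrow> x \<in> C)" if S: "S \<in> W'" for S
    proof -
      obtain S\<^sub>1 S\<^sub>2 where S12: "S\<^sub>1 \<in> W" "S\<^sub>2 \<in> W" and "S = S\<^sub>1 \<union> S\<^sub>2 \<or> S = S\<^sub>1 \<inter> S\<^sub>2 \<or> S = - S\<^sub>1"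
        using W'[OF S] by blast
      then consider (u) "S = S\<^sub>1 \<union> S\<^sub>2" | (i) "S = S\<^sub>1 \<inter> S\<^sub>2" | (c) "S = - S\<^sub>1" by blast
      note cases = this
      obtain T A where TA: "(T, A) \<in> \<T>" "\<forall>x\<in>T. x \<in> S\<^sub>1 \<longleftrightarrow> x \<in> A" using W S12 by blast
      obtain T' B where TB: "(T', B) \<in> \<T>" "\<forall>x\<in>T'. x \<in> S\<^sub>2 \<longleftrightarrow> x \<in> B" using W S12 by blast
      have mem: "(T \<inter> T', h A B) \<in> ?f ` ?D" if "h \<in> ?ops" for h
        using that TA(1) TB(1) by (intro image_eqI[of _ _ "(h, (T, A), (T', B))"]) simp_all
      show ?thesis
      proof (cases rule: cases)
        case u
        have "\<forall>x\<in>T \<inter> T'. x \<in> S \<longleftrightarrow> x \<in> A \<union> B" using u TA(2) TB(2) by blast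
        then show ?thesis using mem[of "(\<union>)"] by blast
      next
        case i
        have "\<forall>x\<in>T \<inter> T'. x \<in> S \<longleftrightarrow> x \<in> A \<inter> B" using i TA(2) TB(2) by blast
        then show ?thesis using mem[of "(\<inter>)"] by blast
      next
        case c
        have "\<forall>x\<in>T \<inter> T'. x \<in> S \<longleftrightarrow> x \<in> - A" using c TA(2) by blast
        then show ?thesis using mem[of "\<lambda>A B. - A"] by blast
      qed
    qed
  qed
qed

text \<open>Replacing \<open>M\<close> by \<open>3 * (M * M)\<close> squares the quantity
  \<open>3 * M\<close>, hence the form of the bound; each operation doubles the error.\<close>

lemma semialg_class_resolvable:
  assumes "finite X" and "resolvable (1 - \<delta>) K X (semialg_class \<Delta> 0) (\<lambda>x S. x \<in> S)"
  shows "\<exists>M. 3 * M \<le> (3 * K) ^ 2 ^ s \<and>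
    resolvable (1 - 2 ^ s * \<delta>) M X (semialg_class \<Delta> s) (\<lambda>x S. x \<in> S)"
proof (induction s)
  case 0
  show ?case using assms(2) by (intro exI[of _ K]) simp
next
  case (Suc s)
  then obtain M where M: "3 * M \<le> (3 * K) ^ 2 ^ s"
    and R: "resolvable (1 - 2 ^ s * \<delta>) M X (semialg_class \<Delta> s) (\<lambda>x S. x \<in> S)" by blast
  have "resolvable (1 - 2 * (2 ^ s * \<delta>)) (3 * (M * M)) X (semialg_class \<Delta> (Suc s)) (\<lambda>x S. x \<in> S)"
    using assms(1) R semialg_class_Suc by (rule resolvable_boolean_step)
  moreover have "3 * (3 * (M * M)) \<le> (3 * K) ^ 2 ^ Suc s"
  proof -
    have "3 * (3 * (M * M)) = 3 * M * (3 * M)" by simp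
    also have "\<dots> \<le> (3 * K) ^ 2 ^ s * (3 * K) ^ 2 ^ s" by (rule mult_le_mono[OF M M])
    also have "\<dots> = (3 * K) ^ 2 ^ Suc s" by (simp only: power_Suc mult_2 power_add)
    finally show ?thesis .
  qed
  ultimately show ?case by (intro exI[of _ "3 * (M * M)"]) (simp add: mult.assoc)
qed

section \<open>Containers of polynomial size\<close>

lemma container_of_resolvable:
  assumes "finite X" and gen: "generated_by X \<R> W"
    and R: "resolvable (1 - \<epsilon>) K X W (\<lambda>x S. x \<in> S)"
  shows "\<exists>\<C>. is_container \<epsilon> X \<R> \<C> \<and> card \<C> \<le> K"
proof -
  obtain \<T> where \<T>: "finite \<T>" "card \<T> \<le> K"
    and T: "\<forall>T A. (T, A) \<in> \<T> \<longrightarrow> T \<subseteq> X \<and> (1 - \<epsilon>) * real (card X) \<le> real (card T)"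
    and W: "\<forall>S\<in>W. \<exists>T A. (T, A) \<in> \<T> \<and> (\<forall>x\<in>T. x \<in> S \<longleftrightarrow> x \<in> A)"
    using R by (rule resolvableE)
  \<comment> \<open>The container drops exactly the points that the guess places outside the set;
    all unresolved points stay in. For a right guess the excess over \<open>R\<close> therefore lies
    in \<open>X - T\<close>.\<close>
  let ?f = "\<lambda>(T, A). X - (T - A)"
  have "\<exists>C\<in>?f ` \<T>. R \<subseteq> C \<and> real (card (C - R)) \<le> \<epsilon> * real (card X)" if R: "R \<in> \<R>" for R
  proof -
    obtain S where S: "S \<in> W" "R = S \<inter> X" using gen R unfolding generated_by_def by blast
    then obtain T A where TA: "(T, A) \<in> \<T>" "\<forall>x\<in>T. x \<in> S \<longleftrightarrow> x \<in> A" using W by blast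
    note t = T[rule_format, OF TA(1)]
    have "card (?f (T, A) - R) \<le> card (X - T)"
      using assms(1) TA(2) S(2) by (intro card_mono) auto
    moreover have "real (card (X - T)) = real (card X) - real (card T)"
      using t assms(1) by (simp add: card_Diff_subset finite_subset[of T X] card_mono)
    ultimately have "real (card (?f (T, A) - R)) \<le> \<epsilon> * real (card X)"
      using t by (simp add: algebra_simps)
    moreover have "R \<subseteq> ?f (T, A)" using S(2) TA(2) by auto
    ultimately show ?thesis using TA(1) by blast
  qed
  then have "is_container \<epsilon> X \<R> (?f ` \<T>)" unfolding is_container_def by auto
  moreover have "card (?f ` \<T>) \<le> K" using card_image_le[OF \<T>(1), of ?f] \<T>(2) by simp
  ultimately show ?thesis by blast
qed

text \<open>The number of rounds needed is logarithmic in \<open>1 / \<epsilon>\<close>, and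
  \<open>K\<close> raised to a logarithm is a power of \<open>1 / \<epsilon>\<close>.\<close>

lemma polynomial_iteration_bound:
  fixes \<rho> :: real and K s :: nat
  assumes \<rho>: "0 < \<rho>" "\<rho> < 1" and "1 \<le> K"
  obtains D \<kappa> :: real where "0 \<le> D" "2 < \<kappa>"
    "\<forall>\<epsilon>. 0 < \<epsilon> \<and> \<epsilon> < 1 \<longrightarrow>
      (\<exists>t. 2 ^ s * (1 - \<rho>) ^ t \<le> \<epsilon> \<and> real ((3 * K ^ t) ^ 2 ^ s) \<le> exp D * (4 / \<epsilon>) powr \<kappa>)"
proof -
  define L where "L = - ln (1 - \<rho>)"
  have L: "0 < L" "1 - \<rho> = exp (- L)" unfolding L_def using \<rho> by auto
  have K: "0 \<le> ln (real K)" using \<open>1 \<le> K\<close> by simp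
  \<comment> \<open>\<open>D\<close> collects what is free of \<open>\<epsilon>\<close>: the factor
    \<open>3\<close>, one round lost to rounding up, and the rounds that pay for
    \<open>2 ^ s\<close>.\<close>
  define D where "D = 2 ^ s * (ln 3 + ln K + ln K * (s * ln 2 / L))"
  \<comment> \<open>The lower limit \<open>3\<close> ensures \<open>2 < \<kappa>\<close>, from which
    \<open>\<Lambda> < 1\<close> will follow.\<close>
  define \<kappa> where "\<kappa> = max 3 (2 ^ s * ln K / L)"
  show thesis
  proof (rule that)
    show "0 \<le> D" unfolding D_def using K L by simp
    show "2 < \<kappa>" unfolding \<kappa>_def by simp
    show "\<forall>\<epsilon>. 0 < \<epsilon> \<and> \<epsilon> < 1 \<longrightarrow>
        (\<exists>t. 2 ^ s * (1 - \<rho>) ^ t \<le> \<epsilon> \<and> real ((3 * K ^ t) ^ 2 ^ s) \<le> exp D * (4 / \<epsilon>) powr \<kappa>)"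
    proof (intro allI impI, elim conjE)
      fix \<epsilon> :: real assume \<epsilon>: "0 < \<epsilon>" "\<epsilon> < 1"
      \<comment> \<open>\<open>y\<close> is the logarithm of \<open>2 ^ s / \<epsilon>\<close>, and
        each round lowers the logarithm of the open fraction by \<open>L\<close>.\<close>
      define y where "y = s * ln 2 + ln (1 / \<epsilon>)"
      have y: "0 \<le> y" unfolding y_def using \<epsilon> by simp
      define t where "t = nat \<lceil>y / L\<rceil>"
      have t: "y / L \<le> t" "t \<le> y / L + 1" unfolding t_def using y L(1) by (auto simp: of_nat_ceiling)
      have "(1 - \<rho>) ^ t = exp (- (L * t))" unfolding L(2) by (simp add: exp_of_nat_mult[symmetric] mult.commute)
      also have "\<dots> \<le> exp (- y)" using t(1) L(1) by (simp add: field_simps)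
      also have "\<dots> = \<epsilon> / 2 ^ s"
        unfolding y_def using \<epsilon> by (simp add: exp_add exp_diff exp_minus ln_div exp_of_nat_mult field_simps)
      finally have "2 ^ s * (1 - \<rho>) ^ t \<le> \<epsilon>" by (simp add: field_simps)
      moreover have "real ((3 * K ^ t) ^ 2 ^ s) = exp (2 ^ s * (ln 3 + t * ln K))"
      proof -
        have "exp (ln 3 + t * ln K) = 3 * real K ^ t"
          using \<open>1 \<le> K\<close> by (simp add: exp_add exp_of_nat_mult)
        then show ?thesis using exp_of_nat_mult[of "2 ^ s" "ln 3 + t * ln K"] by simp
      qed
      moreover have "2 ^ s * (ln 3 + t * ln K) \<le> D + 2 ^ s * ln K / L * ln (1 / \<epsilon>)"
      proof -
        have "t * ln K \<le> (y / L + 1) * ln K" using t(2) K by (rule mult_right_mono)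
        then have "2 ^ s * (ln 3 + t * ln K) \<le> 2 ^ s * (ln 3 + (y / L + 1) * ln K)" by simp
        also have "\<dots> = D + 2 ^ s * ln K / L * ln (1 / \<epsilon>)"
          unfolding D_def y_def using L(1) by (simp add: field_simps)
        finally show ?thesis .
      qed
      moreover have "2 ^ s * ln K / L * ln (1 / \<epsilon>) \<le> \<kappa> * ln (4 / \<epsilon>)"
      proof (rule mult_mono)
        show "ln (1 / \<epsilon>) \<le> ln (4 / \<epsilon>)" using \<epsilon> by (subst ln_le_cancel_iff) (auto simp: field_simps)
        show "0 \<le> ln (1 / \<epsilon>)" using \<epsilon> by simp
      qed (auto simp: \<kappa>_def)
      ultimately have "2 ^ s * (1 - \<rho>) ^ t \<le> \<epsilon> \<and> real ((3 * K ^ t) ^ 2 ^ s) \<le> exp (D + \<kappa> * ln (4 / \<epsilon>))"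
        by simp
      also have "exp (D + \<kappa> * ln (4 / \<epsilon>)) = exp D * (4 / \<epsilon>) powr \<kappa>"
        using \<epsilon> by (simp add: exp_add powr_def)
      finally show "\<exists>t. 2 ^ s * (1 - \<rho>) ^ t \<le> \<epsilon> \<and>
          real ((3 * K ^ t) ^ 2 ^ s) \<le> exp D * (4 / \<epsilon>) powr \<kappa>" by blast
    qed
  qed
qed

text \<open>The polynomial inequalities are resolved first, up to a fraction
  \<open>\<epsilon> / 2 ^ s\<close>, because each Boolean operation afterwards doubles the
  error.\<close>

lemma semialg_container_polynomial:
  "\<exists>D \<kappa> :: real. 0 \<le> D \<and> 2 < \<kappa> \<and>
    (\<forall>(X :: (real ^ 'd) set) \<R> \<epsilon>. finite X \<and> generated_by X \<R> (semialg_class \<Delta> s) \<and> 0 < \<epsilon> \<and> \<epsilon> < 1 \<longrightarrow>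
      (\<exists>\<C>. is_container \<epsilon> X \<R> \<C> \<and> real (card \<C>) \<le> exp D * (4 / \<epsilon>) powr \<kappa>))"
proof -
  obtain \<rho>\<^sub>0 K\<^sub>0 where \<rho>\<^sub>0: "0 < \<rho>\<^sub>0" "\<rho>\<^sub>0 \<le> 1" and R\<^sub>0: "\<forall>X :: (real ^ 'd) set. finite X \<longrightarrow>
      resolvable \<rho>\<^sub>0 K\<^sub>0 X (semialg_class \<Delta> 0) (\<lambda>x S. x \<in> S)"
    using semialg_class_0_resolvable by blast
  \<comment> \<open>Weakened constants: they give \<open>\<rho> < 1\<close> and
    \<open>1 \<le> K\<close>, so that \<open>- ln (1 - \<rho>)\<close> is positive and
    \<open>ln K\<close> nonnegative.\<close>
  define \<rho> K where "\<rho> = \<rho>\<^sub>0 / 2" and "K = Suc K\<^sub>0"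
  have \<rho>: "0 < \<rho>" "\<rho> < 1" and K: "1 \<le> K" unfolding \<rho>_def K_def using \<rho>\<^sub>0 by auto
  have R: "resolvable \<rho> K X (semialg_class \<Delta> 0) (\<lambda>x S. x \<in> S)"
    if "finite X" for X :: "(real ^ 'd) set"
    using R\<^sub>0[rule_format, OF that] by (rule resolvable_mono) (use \<rho>\<^sub>0 in \<open>auto simp: \<rho>_def K_def\<close>)
  obtain D \<kappa> :: real where D: "0 \<le> D" "2 < \<kappa>" and bound: "\<forall>\<epsilon>. 0 < \<epsilon> \<and> \<epsilon> < 1 \<longrightarrow>
      (\<exists>t. 2 ^ s * (1 - \<rho>) ^ t \<le> \<epsilon> \<and> real ((3 * K ^ t) ^ 2 ^ s) \<le> exp D * (4 / \<epsilon>) powr \<kappa>)"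
    using \<rho> K by (rule polynomial_iteration_bound[of \<rho> K s])
  have "\<exists>\<C>. is_container \<epsilon> X \<R> \<C> \<and> real (card \<C>) \<le> exp D * (4 / \<epsilon>) powr \<kappa>"
    if X: "finite X" "generated_by X \<R> (semialg_class \<Delta> s)" and \<epsilon>: "0 < \<epsilon>" "\<epsilon> < 1"
    for X :: "(real ^ 'd) set" and \<R> \<epsilon>
  proof -
    obtain t where t: "2 ^ s * (1 - \<rho>) ^ t \<le> \<epsilon>"
        "real ((3 * K ^ t) ^ 2 ^ s) \<le> exp D * (4 / \<epsilon>) powr \<kappa>"
      using bound \<epsilon> by blast
    have "resolvable \<rho> K J (semialg_class \<Delta> 0) (\<lambda>x S. x \<in> S)" if "J \<subseteq> X" for J
      using R finite_subset[OF that X(1)] by blast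
    then have "resolvable (1 - (1 - \<rho>) ^ t) (K ^ t) X (semialg_class \<Delta> 0) (\<lambda>x S. x \<in> S)"
      using X(1) \<rho>(2) by (intro resolvable_iterate) auto
    from semialg_class_resolvable[OF X(1) this, of s]
    obtain M where M: "3 * M \<le> (3 * K ^ t) ^ 2 ^ s"
      and RM: "resolvable (1 - 2 ^ s * (1 - \<rho>) ^ t) M X (semialg_class \<Delta> s) (\<lambda>x S. x \<in> S)"
      by blast
    have "resolvable (1 - \<epsilon>) M X (semialg_class \<Delta> s) (\<lambda>x S. x \<in> S)"
      using RM by (rule resolvable_mono) (use t(1) in auto)
    then obtain \<C> where \<C>: "is_container \<epsilon> X \<R> \<C>" "card \<C> \<le> M"
      using container_of_resolvable[OF X] by blast
    have "card \<C> \<le> (3 * K ^ t) ^ 2 ^ s" using \<C>(2) M by linarith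
    then have "real (card \<C>) \<le> real ((3 * K ^ t) ^ 2 ^ s)" by (simp only: of_nat_le_iff)
    with t(2) \<C>(1) show ?thesis by (meson order_trans)
  qed
  with D show ?thesis by blast
qed

section \<open>Comparison with the stated bound\<close>

text \<open>A single point suffices as test set: some member of the complement system has a trace of
  size at most \<open>1\<close> on it, so \<open>1 \<le> \<psi> 1 1\<close>, and monotonicity does
  the rest.\<close>

lemma shallow_cell_complexity_ge_1:
  assumes "finite X" "1 \<le> d" "vc_dim X \<R> = enat d" "nondecreasing2 \<psi>"
    and scc: "shallow_cell_complexity X (complement_system X \<R>) \<psi>" and "1 \<le> m" "1 \<le> l"
  shows "1 \<le> \<psi> m l"
proof -
  \<comment> \<open>A nonempty shattered set supplies both a point of \<open>X\<close> and a member
    of \<open>\<R>\<close>.\<close>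
  have "0 < vc_dim X \<R>" using assms(2,3) by (simp add: zero_enat_def)
  then obtain Y where Y: "Y \<subseteq> X" "shatters \<R> Y" "0 < enat (card Y)"
    unfolding vc_dim_def by (auto simp: less_SUP_iff)
  then have "Y \<noteq> {}" by (auto simp: zero_enat_def)
  then obtain y where y: "y \<in> X" using Y(1) by blast
  have "trace \<R> Y \<noteq> {}" using Y(2) unfolding shatters_def by auto
  then obtain R where "R \<in> \<R>" unfolding trace_def by blast
  then have "X - R \<in> complement_system X \<R>" unfolding complement_system_def by blast
  then have "(X - R) \<inter> {y} \<in> trace (complement_system X \<R>) {y}" unfolding trace_def by blast
  moreover have "card ((X - R) \<inter> {y}) \<le> 1" by (rule order_trans[OF card_mono[of "{y}"]]) auto
  ultimately have ne: "(X - R) \<inter> {y} \<in> {T \<in> trace (complement_system X \<R>) {y}. card T \<le> 1}"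
    by blast
  have "finite {T \<in> trace (complement_system X \<R>) {y}. card T \<le> 1}"
    by (rule finite_subset[of _ "Pow {y}"]) (auto simp: trace_def)
  then have "1 \<le> card {T \<in> trace (complement_system X \<R>) {y}. card T \<le> 1}"
    using ne by (metis One_nat_def Suc_leI card_gt_0_iff empty_iff)
  moreover have "real (card {T \<in> trace (complement_system X \<R>) {y}. card T \<le> 1}) \<le> \<psi> 1 1"
    using scc[unfolded shallow_cell_complexity_def, rule_format, of "{y}" 1] y by simp
  ultimately have "1 \<le> \<psi> 1 1" by linarith
  also have "\<dots> \<le> \<psi> m l" using assms(4,6,7) unfolding nondecreasing2_def by simp
  finally show ?thesis .
qed

theorem theorem4p7:
  fixes \<Delta> s :: nat
  assumes "\<Delta> \<ge> 1" and "s \<ge> 1"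
  shows "\<exists>\<Lambda> c\<^sub>0 :: real. 0 < \<Lambda> \<and> \<Lambda> < 1 \<and> 0 < c\<^sub>0 \<and>
    (\<forall>(X :: (real ^ 'd) set) (\<R> :: (real ^ 'd) set set) (d\<^sub>0 :: nat)
       (\<psi> :: real \<Rightarrow> real \<Rightarrow> real) (\<epsilon> :: real).
       finite X \<and> generated_by X \<R> (semialg_class \<Delta> s) \<and>
       d\<^sub>0 \<ge> 1 \<and> vc_dim X \<R> = enat d\<^sub>0 \<and>
       nondecreasing2 \<psi> \<and> shallow_cell_complexity X (complement_system X \<R>) \<psi> \<and>
       0 < \<epsilon> \<and> \<epsilon> < 1 \<longrightarrow>
       (\<exists>\<C>. is_container \<epsilon> X \<R> \<C> \<and>
          real (card \<C>) \<le>
            (c\<^sub>0 * exp 1) ^ d\<^sub>0 *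
            (4 / \<epsilon>) powr (1 + real d\<^sub>0 / ln (inverse (1 - \<Lambda> / 2))) *
            (24 * real d\<^sub>0 / \<epsilon>\<^sup>2) *
            \<psi> (4 * real d\<^sub>0 / \<epsilon>\<^sup>2) (15 * real d\<^sub>0 / \<epsilon>)))"
proof -
  obtain D \<kappa> :: real where D: "0 \<le> D" and \<kappa>: "2 < \<kappa>"
    and container: "\<forall>(X :: (real ^ 'd) set) \<R> \<epsilon>.
      finite X \<and> generated_by X \<R> (semialg_class \<Delta> s) \<and> 0 < \<epsilon> \<and> \<epsilon> < 1 \<longrightarrow>
      (\<exists>\<C>. is_container \<epsilon> X \<R> \<C> \<and> real (card \<C>) \<le> exp D * (4 / \<epsilon>) powr \<kappa>)"
    using semialg_container_polynomial[of \<Delta> s] by blast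
  \<comment> \<open>The solution of \<open>ln (inverse (1 - \<Lambda> / 2)) = 1 / \<kappa>\<close>.
    The exponent of \<open>4 / \<epsilon>\<close> becomes \<open>1 + d\<^sub>0 * \<kappa>\<close>,
    which exceeds \<open>\<kappa>\<close>.\<close>
  define \<Lambda> where "\<Lambda> = 2 * (1 - exp (- (1 / \<kappa>)))"
  have "1 / \<kappa> < 1 / 2" using \<kappa> by (simp add: field_simps)
  moreover have "1 + - (1 / \<kappa>) \<le> exp (- (1 / \<kappa>))" by (rule exp_ge_add_one_self)
  ultimately have "1 / 2 < exp (- (1 / \<kappa>))" by linarith
  moreover have "exp (- (1 / \<kappa>)) < 1" using \<kappa> by simp
  ultimately have \<Lambda>: "0 < \<Lambda>" "\<Lambda> < 1" unfolding \<Lambda>_def by auto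
  have ln\<Lambda>: "ln (inverse (1 - \<Lambda> / 2)) = 1 / \<kappa>"
  proof -
    have "1 - \<Lambda> / 2 = exp (- (1 / \<kappa>))" unfolding \<Lambda>_def by (simp add: diff_divide_distrib)
    then show ?thesis by (simp only: exp_minus[symmetric] minus_minus ln_exp)
  qed
  show ?thesis
  proof (rule exI[of _ \<Lambda>], rule exI[of _ "exp D"], intro conjI allI impI; (elim conjE)?)
    show "0 < \<Lambda>" "\<Lambda> < 1" by (fact \<Lambda>)+
    show "0 < exp D" by simp
    fix X :: "(real ^ 'd) set" and \<R> :: "(real ^ 'd) set set" and d\<^sub>0 :: nat
      and \<psi> :: "real \<Rightarrow> real \<Rightarrow> real" and \<epsilon> :: real
    assume X: "finite X" "generated_by X \<R> (semialg_class \<Delta> s)"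
      and d\<^sub>0: "1 \<le> d\<^sub>0" "vc_dim X \<R> = enat d\<^sub>0"
      and \<psi>: "nondecreasing2 \<psi>" "shallow_cell_complexity X (complement_system X \<R>) \<psi>"
      and \<epsilon>: "0 < \<epsilon>" "\<epsilon> < 1"
    obtain \<C> where \<C>: "is_container \<epsilon> X \<R> \<C>" "real (card \<C>) \<le> exp D * (4 / \<epsilon>) powr \<kappa>"
      using container X \<epsilon> by blast
    have e2: "0 < \<epsilon>\<^sup>2" "\<epsilon>\<^sup>2 \<le> 1" using \<epsilon> by (auto simp: power_le_one)
    have d: "1 \<le> real d\<^sub>0" using d\<^sub>0(1) by simp
    have p: "1 \<le> \<psi> (4 * real d\<^sub>0 / \<epsilon>\<^sup>2) (15 * real d\<^sub>0 / \<epsilon>)"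
    proof (rule shallow_cell_complexity_ge_1[OF X(1) d\<^sub>0 \<psi>])
      show "1 \<le> 4 * real d\<^sub>0 / \<epsilon>\<^sup>2" using e2 d by (simp add: field_simps)
      show "1 \<le> 15 * real d\<^sub>0 / \<epsilon>" using \<epsilon> d by (simp add: field_simps)
    qed
    have q: "1 \<le> 24 * real d\<^sub>0 / \<epsilon>\<^sup>2" using e2 d by (simp add: field_simps)
    \<comment> \<open>With \<open>c\<^sub>0 = exp D\<close> the base is at least \<open>1\<close>,
      so raising it to the power \<open>d\<^sub>0 \<ge> 1\<close> does not decrease it.\<close>
    have "exp D \<le> (exp D * exp 1) ^ d\<^sub>0"
    proof -
      have "1 \<le> exp D * exp 1" using D by (simp flip: exp_add)
      then have "exp D * exp 1 \<le> (exp D * exp 1) ^ d\<^sub>0"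
        using power_increasing[OF d\<^sub>0(1), of "exp D * exp 1"] by simp
      moreover have "exp D \<le> exp D * exp 1" by simp
      ultimately show ?thesis by linarith
    qed
    moreover have "(4 / \<epsilon>) powr \<kappa> \<le> (4 / \<epsilon>) powr (1 + real d\<^sub>0 / ln (inverse (1 - \<Lambda> / 2)))"
    proof (rule powr_mono)
      have "\<kappa> \<le> real d\<^sub>0 * \<kappa>" using d \<kappa> by simp
      then show "\<kappa> \<le> 1 + real d\<^sub>0 / ln (inverse (1 - \<Lambda> / 2))" unfolding ln\<Lambda> by simp
      show "1 \<le> 4 / \<epsilon>" using \<epsilon> by (simp add: field_simps)
    qed
    ultimately have "exp D * (4 / \<epsilon>) powr \<kappa> \<le>
        (exp D * exp 1) ^ d\<^sub>0 * (4 / \<epsilon>) powr (1 + real d\<^sub>0 / ln (inverse (1 - \<Lambda> / 2)))" (is "_ \<le> ?B")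
      by (intro mult_mono) auto
    also have "\<dots> \<le> ?B * (24 * real d\<^sub>0 / \<epsilon>\<^sup>2)"
      using mult_left_mono[OF q, of ?B] by simp
    also have "\<dots> \<le> ?B * (24 * real d\<^sub>0 / \<epsilon>\<^sup>2) * \<psi> (4 * real d\<^sub>0 / \<epsilon>\<^sup>2) (15 * real d\<^sub>0 / \<epsilon>)"
      using mult_left_mono[OF p, of "?B * (24 * real d\<^sub>0 / \<epsilon>\<^sup>2)"] q by simp
    finally show "\<exists>\<C>. is_container \<epsilon> X \<R> \<C> \<and> real (card \<C>) \<le>
        ?B * (24 * real d\<^sub>0 / \<epsilon>\<^sup>2) * \<psi> (4 * real d\<^sub>0 / \<epsilon>\<^sup>2) (15 * real d\<^sub>0 / \<epsilon>)"
      using \<C> by (meson order_trans)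
  qed
qed

end
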